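(* Let $s>0$ and let $(F,d)$ be a non-empty, totally bounded, locally compact, $s$-Ahlfors--David regular metric space. Then $$\sigma(F)\subset[1,1+1/s],$$ and for any choice $P$ of abstract rationals in $F$ (with $F_t$ defined using $P$) we have $$\dim_{\mathrm H}F_t\geq\frac{d(P)\,s}{t}\qquad\text{for all } t\geq d(P).$$
   Context: For a non-empty totally bounded metric space $(F,d)$, a set $A\subseteq F$ is $r$-separated if $d(a,b)\geq r$ for all distinct $a,b\in A$. A choice of abstract rationals in $F$ is a family $P=(P(q))_{q\in\mathbb{N}}$, $\mathbb N=\{1,2,\dots\}$, where each $P(q)\subseteq F$ is a maximal $(1/q)$-separated set, i.e. it is $(1/q)$-separated and no further point of $F$ can be added while keeping it $(1/q)$-separated. Given such a choice and $t>0$, $$F_t=\bigcap_{N}\bigcup_{q>N}\bigcup_{p\in P(q)}B(p,1/q^t),$$ where $B(x,r)$ denotes the closed ball in $F$; that is, $F_t$ is the set of $x\in F$ such that for infinitely many $q$ there is $p\in P(q)$ with $d(p,x)\leq 1/q^t$. $\mathcal{H}^s$ denotes $s$-dimensional Hausdorff measure and $\dim_{\mathrm H}$ Hausdorff dimension. $F$ is $s$-Ahlfors--David regular if there is a constant $C>0$ such that $r^s/C\leq\mathcal{H}^s(B(x,r))\leq Cr^s$ for all $0<r<1$ and all $x\in F$. For an $s$-Ahlfors--David regular $F$ and a choice $P$ of abstract rationals in $F$, the Dirichlet exponent is $$d(P)=\sup\{\delta>0 : \text{there is a ball } B\subset F \text{ of positive radius with } \mathcal{H}^s(B\setminus F_\delta)=0\},$$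 and the Dirichlet spectrum of $F$ is $\sigma(F)=\{d(P): P\text{ is a choice of abstract rationals in }F\}$. *)

theory Defs
  imports "HOL-Analysis.Analysis"
begin

text \<open>
  The metric space is a carrier set \<open>F\<close> in a type of class \<^class>\<open>metric_space\<close>, with the
  induced distance; balls of \<open>F\<close> are the sets \<open>cball x r \<inter> F\<close> with \<open>x \<in> F\<close>.
\<close>

section \<open>Hausdorff measure and Hausdorff dimension\<close>

text \<open>
  \<open>(diam U)\<^sup>s\<close> with the usual conventions that the empty set contributes \<open>0\<close> and that \<open>0\<^sup>0 = 1\<close>
  (for \<open>powr\<close> one has \<open>0 powr 0 = 0\<close>).
\<close>

definition diam_pow :: "real \<Rightarrow> 'a::metric_space set \<Rightarrow> ennreal" where
  "diam_pow s U =
     (if U = {} then 0 else if s = 0 then 1 else ennreal (diameter U powr s))"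

text \<open>
  Boundedness of the covering sets is required explicitly because \<^const>\<open>diameter\<close> is real-valued
  and unspecified on unbounded sets. Finite covers are included, as covering sets may be empty.
\<close>

definition hausdorff_premeasure :: "real \<Rightarrow> real \<Rightarrow> 'a::metric_space set \<Rightarrow> ennreal" where
  "hausdorff_premeasure s \<delta> A =
     Inf {(\<Sum>i. diam_pow s (U i)) | U :: nat \<Rightarrow> 'a set.
            A \<subseteq> (\<Union>i. U i) \<and> (\<forall>i. bounded (U i) \<and> diameter (U i) \<le> \<delta>)}"

definition hausdorff_measure :: "real \<Rightarrow> 'a::metric_space set \<Rightarrow> ennreal" where
  "hausdorff_measure s A = (SUP \<delta>\<in>{0<..}. hausdorff_premeasure s \<delta> A)"

definition hausdorff_dim :: "'a::metric_space set \<Rightarrow> ereal" where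
  "hausdorff_dim A = Inf {ereal s | s. 0 \<le> s \<and> hausdorff_measure s A = 0}"

definition ahlfors_david_regular :: "real \<Rightarrow> 'a::metric_space set \<Rightarrow> bool" where
  "ahlfors_david_regular s F \<longleftrightarrow>
     (\<exists>C>0. \<forall>r x. 0 < r \<and> r < 1 \<and> x \<in> F \<longrightarrow>
        ennreal (r powr s / C) \<le> hausdorff_measure s (cball x r \<inter> F) \<and>
        hausdorff_measure s (cball x r \<inter> F) \<le> ennreal (C * r powr s))"

section \<open>Abstract rationals and the Dirichlet spectrum\<close>

definition separated_by :: "real \<Rightarrow> 'a::metric_space set \<Rightarrow> bool" where
  "separated_by r A \<longleftrightarrow> (\<forall>a\<in>A. \<forall>b\<in>A. a \<noteq> b \<longrightarrow> r \<le> dist a b)"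

definition maximal_separated :: "real \<Rightarrow> 'a::metric_space set \<Rightarrow> 'a set \<Rightarrow> bool" where
  "maximal_separated r F A \<longleftrightarrow>
     A \<subseteq> F \<and> separated_by r A \<and> (\<forall>x\<in>F - A. \<not> separated_by r (insert x A))"

text \<open>Only the sets \<open>P q\<close> with \<open>q \<ge> 1\<close> matter; \<open>P 0\<close> is arbitrary and never used below.\<close>

definition abstract_rationals :: "'a::metric_space set \<Rightarrow> (nat \<Rightarrow> 'a set) \<Rightarrow> bool" where
  "abstract_rationals F P \<longleftrightarrow> (\<forall>q\<ge>1. maximal_separated (1 / real q) F (P q))"

definition well_approx ::
    "'a::metric_space set \<Rightarrow> (nat \<Rightarrow> 'a set) \<Rightarrow> real \<Rightarrow> 'a set" where
  "well_approx F P t =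
     (\<Inter>N. \<Union>q\<in>{N<..}. \<Union>p\<in>P q. cball p (1 / real q powr t) \<inter> F)"

text \<open>
  The supremum is taken in \<^typ>\<open>ereal\<close>, so that it is meaningful without knowing beforehand
  that the set is non-empty and bounded.
\<close>

definition dirichlet_exponent ::
    "real \<Rightarrow> 'a::metric_space set \<Rightarrow> (nat \<Rightarrow> 'a set) \<Rightarrow> ereal" where
  "dirichlet_exponent s F P =
     Sup {ereal \<delta> | \<delta>. 0 < \<delta> \<and>
            (\<exists>x\<in>F. \<exists>r>0. hausdorff_measure s ((cball x r \<inter> F) - well_approx F P \<delta>) = 0)}"

definition dirichlet_spectrum :: "real \<Rightarrow> 'a::metric_space set \<Rightarrow> ereal set" where
  "dirichlet_spectrum s F = {dirichlet_exponent s F P | P. abstract_rationals F P}"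

end

theory Submission
  imports Defs
begin

text \<open>
  \<open>F\<^sub>1 = F\<close> by maximality, so \<open>d(P) \<ge> 1\<close>. A ball contains at most a constant times \<open>q\<^sup>s\<close> points of \<open>P(q)\<close>,
  so the balls of radius \<open>1/q\<^sup>\<delta>\<close> around them have measure at most a constant times \<open>q\<^bsup>s - \<delta>s\<^esup>\<close>, which is
  summable for \<open>\<delta> > 1 + 1/s\<close>; then \<open>F\<^sub>\<delta>\<close> is locally null.

  For the dimension bound, suppose that \<open>F\<^sub>\<delta>\<close> has full measure in a ball and that \<open>F\<^sub>t\<close> has a cover by
  sets \<open>U\<^sub>i\<close> with \<open>\<Sum>|U\<^sub>i|\<^sup>v\<close> tiny, where \<open>v < \<delta>s/t\<close>. We construct nested balls \<open>B(p,1/q\<^sup>t)\<close>, with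
  \<open>p \<in> P(q)\<close>, whose common point lies in \<open>F\<^sub>t\<close> but in no \<open>U\<^sub>i\<close>. The invariant for a ball of radius \<open>r\<close>
  is \<open>\<Sum>|U\<^sub>i|\<^sup>v \<le> (\<theta>r)\<^sup>v\<close> over the sets hitting it. Inside such a ball the Vitali argument yields finitely
  many well separated balls \<open>B(p,1/q\<^sup>\<delta>)\<close> of total measure at least a constant times \<open>r\<^sup>s\<close>. Sets \<open>U\<^sub>i\<close>
  larger than the balls they hit spoil only a small proportion of them, and each smaller \<open>U\<^sub>i\<close> hits
  at most one. Since \<open>\<Sum>(1/q\<^sup>t)\<^sup>v\<close> is much larger than \<open>\<Sum>(1/q\<^sup>\<delta>)\<^sup>s\<close> for large \<open>q\<close>, the pigeonhole
  principle gives a ball \<open>B(p,1/q\<^sup>t)\<close> with the invariant.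
\<close>

section \<open>Hausdorff measure as a metric outer measure\<close>

lemma hausdorff_premeasure_le:
  assumes "A \<subseteq> (\<Union>i. U i)" "\<And>i. bounded (U i)" "\<And>i. diameter (U i) \<le> \<delta>"
  shows "hausdorff_premeasure s \<delta> A \<le> (\<Sum>i. diam_pow s (U i))"
  unfolding hausdorff_premeasure_def using assms by (intro Inf_lower) blast

lemma hausdorff_premeasure_lessE:
  assumes "hausdorff_premeasure s \<delta> A < c"
  obtains U where "A \<subseteq> (\<Union>i. U i)" "\<And>i. bounded (U i)" "\<And>i. diameter (U i) \<le> \<delta>"
    "(\<Sum>i. diam_pow s (U i)) < c"
  using assms unfolding hausdorff_premeasure_def Inf_less_iff by blast

lemma hausdorff_premeasure_mono:
  assumes "A \<subseteq> B"
  shows "hausdorff_premeasure s \<delta> A \<le> hausdorff_premeasure s \<delta> B"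
  unfolding hausdorff_premeasure_def using assms by (intro Inf_superset_mono) blast

lemma hausdorff_premeasure_antimono:
  assumes "\<delta> \<le> \<delta>'"
  shows "hausdorff_premeasure s \<delta>' A \<le> hausdorff_premeasure s \<delta> A"
  unfolding hausdorff_premeasure_def using assms by (intro Inf_superset_mono) (blast intro: order_trans)

lemma hausdorff_premeasure_le_measure:
  "\<delta> > 0 \<Longrightarrow> hausdorff_premeasure s \<delta> A \<le> hausdorff_measure s A"
  unfolding hausdorff_measure_def by (intro SUP_upper) auto

lemma hausdorff_measure_mono:
  assumes "A \<subseteq> B"
  shows "hausdorff_measure s A \<le> hausdorff_measure s B"
  unfolding hausdorff_measure_def by (intro SUP_mono) (use hausdorff_premeasure_mono[OF assms] in blast)

lemma hausdorff_measure_empty [simp]: "hausdorff_measure s {} = 0"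
proof -
  have *: "hausdorff_premeasure s \<delta> {} = 0" if "\<delta> > 0" for \<delta>
    using hausdorff_premeasure_le[of "{}" "\<lambda>_. {}" \<delta> s] that by (simp add: diam_pow_def)
  have "hausdorff_measure s {} = (SUP \<delta>\<in>{0::real<..}. 0)"
    unfolding hausdorff_measure_def by (rule SUP_cong) (use * in auto)
  then show ?thesis by simp
qed

lemma hausdorff_premeasure_UN_le:
  "hausdorff_premeasure s \<delta> (\<Union>n. A n) \<le> (\<Sum>n. hausdorff_premeasure s \<delta> (A n))"
proof (rule ennreal_le_epsilon)
  fix e :: real
  assume fin: "(\<Sum>n. hausdorff_premeasure s \<delta> (A n)) < top" and e: "0 < e"
  have "\<exists>U. A n \<subseteq> (\<Union>i. U i) \<and> (\<forall>i. bounded (U i) \<and> diameter (U i) \<le> \<delta>) \<and>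
      (\<Sum>i. diam_pow s (U i)) < hausdorff_premeasure s \<delta> (A n) + e * (1/2) ^ Suc n" for n
  proof -
    \<comment> \<open>Only below infinity does adding a positive error give something strictly
      larger, which is what yields a nearly optimal cover. The errors of all levels add up to
      \<open>e\<close>.\<close>
    have "hausdorff_premeasure s \<delta> (A n) < top"
      by (rule ennreal_suminf_lessD[OF fin])
    then have "hausdorff_premeasure s \<delta> (A n) < hausdorff_premeasure s \<delta> (A n) + e * (1/2) ^ Suc n"
      using e by (simp add: ennreal_zero_less_mult_iff)
    then show ?thesis by (elim hausdorff_premeasure_lessE) blast
  qed
  then obtain U where cover: "\<And>n. A n \<subseteq> (\<Union>i. U n i)"
    and diam: "\<And>n i. bounded (U n i) \<and> diameter (U n i) \<le> \<delta>"
    and sum: "\<And>n. (\<Sum>i. diam_pow s (U n i)) < hausdorff_premeasure s \<delta> (A n) + e * (1/2) ^ Suc n"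
    by metis
  define V where "V k = (\<lambda>(n, i). U n i) (prod_decode k)" for k
  have "(\<Union>n. A n) \<subseteq> (\<Union>k. V k)"
  proof
    fix x assume "x \<in> (\<Union>n. A n)"
    then obtain n i where "x \<in> U n i" using cover by blast
    then have "x \<in> V (prod_encode (n, i))" by (simp add: V_def)
    then show "x \<in> (\<Union>k. V k)" by blast
  qed
  then have "hausdorff_premeasure s \<delta> (\<Union>n. A n) \<le> (\<Sum>k. diam_pow s (V k))"
    by (rule hausdorff_premeasure_le) (use diam in \<open>auto simp: V_def split: prod.splits\<close>)
  also have "\<dots> = (\<Sum>k. (\<lambda>(n, i). diam_pow s (U n i)) (prod_decode k))"
    by (simp add: V_def case_prod_unfold)
  also have "\<dots> = (\<Sum>n. \<Sum>i. diam_pow s (U n i))"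
    by (rule suminf_ennreal_2dimen) simp
  also have "\<dots> \<le> (\<Sum>n. hausdorff_premeasure s \<delta> (A n) + ennreal (e * (1/2) ^ Suc n))"
    by (intro suminf_le order_less_imp_le sum) auto
  also have "\<dots> = (\<Sum>n. hausdorff_premeasure s \<delta> (A n)) + (\<Sum>n. ennreal (e * (1/2) ^ Suc n))"
    by (intro suminf_add[symmetric]) auto
  also have "(\<Sum>n. ennreal (e * (1/2) ^ Suc n)) = e"
  proof (rule suminf_ennreal_eq)
    show "(\<lambda>n. e * (1/2) ^ Suc n) sums e"
      using sums_mult[OF power_half_series, of e] by simp
  qed (use e in simp)
  finally show "hausdorff_premeasure s \<delta> (\<Union>n. A n)
      \<le> (\<Sum>n. hausdorff_premeasure s \<delta> (A n)) + ennreal e" .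
qed

lemma hausdorff_measure_UN_le:
  "hausdorff_measure s (\<Union>n. A n) \<le> (\<Sum>n::nat. hausdorff_measure s (A n))"
  unfolding hausdorff_measure_def[of s "\<Union>n. A n"]
proof (rule SUP_least)
  fix \<delta> :: real assume "\<delta> \<in> {0<..}"
  then have "(\<Sum>n. hausdorff_premeasure s \<delta> (A n)) \<le> (\<Sum>n. hausdorff_measure s (A n))"
    by (intro suminf_le hausdorff_premeasure_le_measure) auto
  with hausdorff_premeasure_UN_le
  show "hausdorff_premeasure s \<delta> (\<Union>n. A n) \<le> (\<Sum>n. hausdorff_measure s (A n))"
    by (rule order_trans)
qed

lemma hausdorff_measure_Un_le:
  "hausdorff_measure s (A \<union> B) \<le> hausdorff_measure s A + hausdorff_measure s B"
proof -
  define D where "D n = (if n = 0 then A else if n = 1 then B else {})" for n :: nat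
  have "(\<Union>n. D n) = A \<union> B" by (auto simp: D_def split: if_splits)
  moreover have "(\<Sum>n. hausdorff_measure s (D n)) = (\<Sum>n\<in>{0, 1}. hausdorff_measure s (D n))"
    by (rule suminf_finite) (auto simp: D_def)
  ultimately show ?thesis using hausdorff_measure_UN_le[of s D] by (simp add: D_def)
qed

lemma hausdorff_measure_finite_UN_le:
  assumes "finite I"
  shows "hausdorff_measure s (\<Union>i\<in>I. A i) \<le> (\<Sum>i\<in>I. hausdorff_measure s (A i))"
  using assms
proof induction
  case (insert i I)
  have "hausdorff_measure s (\<Union>i\<in>insert i I. A i)
      \<le> hausdorff_measure s (A i) + hausdorff_measure s (\<Union>i\<in>I. A i)"
    using hausdorff_measure_Un_le[of s "A i" "\<Union>i\<in>I. A i"] by simp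
  with insert show ?case by (auto intro: order_trans add_left_mono)
qed auto

text \<open>A covering set of diameter below the gap cannot meet both sets, so every cover of the
  union splits into a cover of each.\<close>

lemma hausdorff_premeasure_gap:
  assumes "0 < \<delta>" "\<delta> < g" and gap: "\<And>a b. a \<in> A \<Longrightarrow> b \<in> B \<Longrightarrow> g \<le> dist a b"
  shows "hausdorff_premeasure s \<delta> A + hausdorff_premeasure s \<delta> B \<le> hausdorff_premeasure s \<delta> (A \<union> B)"
  unfolding hausdorff_premeasure_def[of s \<delta> "A \<union> B"]
proof (rule Inf_greatest, clarify)
  fix U :: "nat \<Rightarrow> 'a set"
  assume cover: "A \<union> B \<subseteq> (\<Union>i. U i)" and U: "\<forall>i. bounded (U i) \<and> diameter (U i) \<le> \<delta>"
  \<comment> \<open>Sets missing \<open>X\<close> become empty instead of being dropped: this keeps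
    the indexing, and the empty set weighs 0 for every \<open>s\<close>, including
    \<open>s = 0\<close>.\<close>
  define V where "V X i = (if U i \<inter> X = {} then {} else U i)" for X i
  have V: "hausdorff_premeasure s \<delta> X \<le> (\<Sum>i. diam_pow s (V X i))" if X: "X \<subseteq> A \<union> B" for X
  proof (rule hausdorff_premeasure_le)
    show "X \<subseteq> (\<Union>i. V X i)"
    proof
      fix x assume x: "x \<in> X"
      then obtain i where "x \<in> U i" using X cover by blast
      with x have "x \<in> V X i" by (auto simp: V_def)
      then show "x \<in> (\<Union>i. V X i)" by blast
    qed
  qed (use U assms(1) in \<open>auto simp: V_def\<close>)
  have "U i \<inter> A = {} \<or> U i \<inter> B = {}" for i
  proof (rule ccontr)
    assume "\<not> ?thesis"
    then obtain a b where ab: "a \<in> U i" "a \<in> A" "b \<in> U i" "b \<in> B" by blast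
    then have "dist a b \<le> diameter (U i)" using U by (intro diameter_bounded_bound) auto
    with U gap[OF ab(2,4)] assms(2) show False
      by (metis order_less_le_trans order_less_irrefl order_trans)
  qed
  then have "diam_pow s (V A i) + diam_pow s (V B i) \<le> diam_pow s (U i)" for i
    by (cases "U i \<inter> A = {}") (auto simp: V_def diam_pow_def)
  then have "(\<Sum>i. diam_pow s (V A i) + diam_pow s (V B i)) \<le> (\<Sum>i. diam_pow s (U i))"
    by (intro suminf_le) auto
  moreover have "(\<Sum>i. diam_pow s (V A i) + diam_pow s (V B i))
      = (\<Sum>i. diam_pow s (V A i)) + (\<Sum>i. diam_pow s (V B i))"
    by (intro suminf_add[symmetric]) auto
  ultimately show "hausdorff_premeasure s \<delta> A + hausdorff_premeasure s \<delta> B \<le> (\<Sum>i. diam_pow s (U i))"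
    using add_mono[OF V[of A] V[of B]] by (auto intro: order_trans)
qed

text \<open>The scales for the two sets are independent in the sum of the suprema; shrinking both to
  one scale below the gap only increases the premeasures. This stands in for additivity on
  measurable sets in all that follows.\<close>

lemma hausdorff_measure_gap:
  assumes "0 < g" and gap: "\<And>a b. a \<in> A \<Longrightarrow> b \<in> B \<Longrightarrow> g \<le> dist a b"
  shows "hausdorff_measure s A + hausdorff_measure s B \<le> hausdorff_measure s (A \<union> B)"
proof -
  have *: "hausdorff_premeasure s \<delta>1 A + hausdorff_premeasure s \<delta>2 B \<le> hausdorff_measure s (A \<union> B)"
    if "\<delta>1 > 0" "\<delta>2 > 0" for \<delta>1 \<delta>2
  proof -
    define \<delta> where "\<delta> = min (g / 2) (min \<delta>1 \<delta>2)"
    have \<delta>: "0 < \<delta>" "\<delta> < g" "\<delta> \<le> \<delta>1" "\<delta> \<le> \<delta>2" using that assms(1) by (auto simp: \<delta>_def)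
    have "hausdorff_premeasure s \<delta>1 A + hausdorff_premeasure s \<delta>2 B
        \<le> hausdorff_premeasure s \<delta> A + hausdorff_premeasure s \<delta> B"
      by (intro add_mono hausdorff_premeasure_antimono \<delta>)
    also have "\<dots> \<le> hausdorff_premeasure s \<delta> (A \<union> B)"
      using \<delta> gap by (intro hausdorff_premeasure_gap[of \<delta> g]) auto
    also have "\<dots> \<le> hausdorff_measure s (A \<union> B)" by (rule hausdorff_premeasure_le_measure[OF \<delta>(1)])
    finally show ?thesis .
  qed
  let ?S = "\<lambda>X. SUP \<delta>\<in>{0<..}. hausdorff_premeasure s \<delta> X"
  have "?S A + ?S B = (SUP \<delta>1\<in>{0<..}. hausdorff_premeasure s \<delta>1 A + ?S B)"
    by (rule ennreal_SUP_add_left[symmetric]) simp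
  also have "\<dots> = (SUP \<delta>1\<in>{0<..}. SUP \<delta>2\<in>{0<..}.
      hausdorff_premeasure s \<delta>1 A + hausdorff_premeasure s \<delta>2 B)"
    by (intro SUP_cong refl ennreal_SUP_add_right) auto
  also have "\<dots> \<le> hausdorff_measure s (A \<union> B)"
    by (intro SUP_least *) auto
  finally show ?thesis by (simp add: hausdorff_measure_def[of s A] hausdorff_measure_def[of s B])
qed

lemma sum_hausdorff_measure_gap:
  assumes "finite J" "0 < g"
    and "\<And>i j a b. \<lbrakk>i \<in> J; j \<in> J; i \<noteq> j; a \<in> A i; b \<in> A j\<rbrakk> \<Longrightarrow> g \<le> dist a b"
  shows "(\<Sum>j\<in>J. hausdorff_measure s (A j)) \<le> hausdorff_measure s (\<Union>j\<in>J. A j)"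
  using assms(1,3)
proof (induction)
  case (insert i J)
  have "(\<Sum>j\<in>J. hausdorff_measure s (A j)) \<le> hausdorff_measure s (\<Union>j\<in>J. A j)"
    using insert.prems by (intro insert.IH) blast
  then have "(\<Sum>j\<in>insert i J. hausdorff_measure s (A j))
      \<le> hausdorff_measure s (A i) + hausdorff_measure s (\<Union>j\<in>J. A j)"
    using insert.hyps by (simp add: add_left_mono)
  also have "\<dots> \<le> hausdorff_measure s (A i \<union> (\<Union>j\<in>J. A j))"
    using insert.prems insert.hyps by (intro hausdorff_measure_gap[OF \<open>0 < g\<close>]) blast
  finally show ?case by simp
qed simp

section \<open>Packing and the upper bound for the Dirichlet exponent\<close>

lemma well_approx_iff:
  "x \<in> well_approx F P t \<longleftrightarrow>
     x \<in> F \<and> (\<forall>N. \<exists>q>N. \<exists>p\<in>P q. dist p x \<le> 1 / real q powr t)"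
  unfolding well_approx_def by (auto simp: mem_cball) blast+

lemma well_approx_subset: "well_approx F P t \<subseteq> F"
  by (auto simp: well_approx_iff)

locale ad_regular =
  fixes s C :: real and F :: "'a::metric_space set"
  assumes s_pos: "0 < s" and C_pos: "0 < C"
    and lower: "\<And>x r. \<lbrakk>x \<in> F; 0 < r; r < 1\<rbrakk> \<Longrightarrow> ennreal (r powr s / C) \<le> hausdorff_measure s (cball x r \<inter> F)"
    and upper: "\<And>x r. \<lbrakk>x \<in> F; 0 < r; r < 1\<rbrakk> \<Longrightarrow> hausdorff_measure s (cball x r \<inter> F) \<le> ennreal (C * r powr s)"
begin

text \<open>The balls have positive mutual distance, so their measures add up inside the ball of
  radius \<open>R\<close>; regularity bounds each from below and the large ball from above, costing
  a factor \<open>C\<close> each time.\<close>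

lemma packing:
  fixes p :: "'i \<Rightarrow> 'a" and \<rho> :: "'i \<Rightarrow> real"
  assumes "finite J" "y \<in> F" "0 < R" "R < 1"
    and p: "\<And>j. j \<in> J \<Longrightarrow> p j \<in> F"
    and \<rho>: "\<And>j. j \<in> J \<Longrightarrow> 0 < \<rho> j"
    and sep: "\<And>i j. \<lbrakk>i \<in> J; j \<in> J; i \<noteq> j\<rbrakk> \<Longrightarrow> 3 * \<rho> i \<le> dist (p i) (p j)"
    and sub: "\<And>j. j \<in> J \<Longrightarrow> dist y (p j) + \<rho> j \<le> R"
  shows "(\<Sum>j\<in>J. \<rho> j powr s) \<le> C\<^sup>2 * R powr s"
proof (cases "J = {}")
  case False
  define g where "g = Min (\<rho> ` J)"
  have g: "g > 0" "\<And>j. j \<in> J \<Longrightarrow> g \<le> \<rho> j"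
    using assms(1) False \<rho> by (auto simp: g_def)
  let ?A = "\<lambda>j. cball (p j) (\<rho> j) \<inter> F"
  \<comment> \<open>Applying \<open>sep\<close> in both orders puts the centres at least 3/2 of the
    sum of the radii apart, which leaves half of that sum between the balls.\<close>
  have gap: "g \<le> dist a b" if ij: "i \<in> J" "j \<in> J" "i \<noteq> j" and ab: "a \<in> ?A i" "b \<in> ?A j" for i j a b
  proof -
    have "dist (p i) (p j) \<le> dist (p i) a + dist a b + dist (p j) b"
      using dist_triangle[of "p i" "p j" a] dist_triangle[of a "p j" b] by (simp add: dist_commute)
    moreover have "dist (p i) a \<le> \<rho> i" "dist (p j) b \<le> \<rho> j" using ab by auto
    ultimately have "dist (p i) (p j) \<le> \<rho> i + dist a b + \<rho> j" by simp
    with sep[OF ij] sep[OF ij(2,1)] ij(3) g(2)[OF ij(1)] g(2)[OF ij(2)] show ?thesis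
      by (simp add: dist_commute)
  qed
  have "\<rho> j < 1" if "j \<in> J" for j
    using sub[OF that] assms(4) by (smt (verit) zero_le_dist)
  then have "(\<Sum>j\<in>J. ennreal (\<rho> j powr s / C)) \<le> (\<Sum>j\<in>J. hausdorff_measure s (?A j))"
    by (intro sum_mono lower p \<rho>) auto
  also have "\<dots> \<le> hausdorff_measure s (\<Union>j\<in>J. ?A j)"
    by (rule sum_hausdorff_measure_gap[OF assms(1) g(1)]) (rule gap)
  also have "\<dots> \<le> hausdorff_measure s (cball y R \<inter> F)"
  proof (intro hausdorff_measure_mono UN_least)
    fix j assume "j \<in> J"
    have "dist y z \<le> R" if "dist (p j) z \<le> \<rho> j" for z
      using sub[OF \<open>j \<in> J\<close>] that dist_triangle[of y z "p j"] by linarith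
    then show "?A j \<subseteq> cball y R \<inter> F" by auto
  qed
  also have "\<dots> \<le> ennreal (C * R powr s)" using assms by (intro upper) auto
  finally have "ennreal (\<Sum>j\<in>J. \<rho> j powr s / C) \<le> ennreal (C * R powr s)"
    using C_pos by (simp add: sum_ennreal)
  then have "(\<Sum>j\<in>J. \<rho> j powr s) / C \<le> C * R powr s"
    using C_pos by (simp add: ennreal_le_iff sum_divide_distrib)
  then show ?thesis using C_pos by (simp add: divide_le_eq power2_eq_square mult_ac)
qed (simp add: C_pos)

end

section \<open>Separation, density and counting of abstract rationals\<close>

locale ad_regular_rationals = ad_regular s C F
  for s C :: real and F :: "'a::metric_space set" +
  fixes P :: "nat \<Rightarrow> 'a set"
  assumes rat: "abstract_rationals F P"
begin

lemma rationals_subset: "q \<ge> 1 \<Longrightarrow> P q \<subseteq> F"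
  using rat by (auto simp: abstract_rationals_def maximal_separated_def)

lemma rationals_separated: "\<lbrakk>q \<ge> 1; a \<in> P q; b \<in> P q; a \<noteq> b\<rbrakk> \<Longrightarrow> 1 / real q \<le> dist a b"
  using rat by (auto simp: abstract_rationals_def maximal_separated_def separated_by_def)

lemma rationals_dense:
  assumes "q \<ge> 1" "x \<in> F"
  obtains p where "p \<in> P q" "dist p x \<le> 1 / real q"
proof (cases "x \<in> P q")
  case False
  with assms rat have *: "\<not> separated_by (1 / real q) (insert x (P q))"
    by (auto simp: abstract_rationals_def maximal_separated_def)
  have "\<exists>p\<in>P q. dist p x \<le> 1 / real q"
  proof (rule ccontr)
    assume "\<not> ?thesis"
    then have "separated_by (1 / real q) (insert x (P q))"
      using rationals_separated[OF assms(1)] unfolding separated_by_def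
      by (auto simp: dist_commute not_le intro: less_imp_le)
    with * show False by simp
  qed
  then show ?thesis using that by blast
qed (use that[of x] in simp)

lemma well_approx_1: "well_approx F P 1 = F"
proof -
  have "x \<in> well_approx F P 1" if "x \<in> F" for x
    unfolding well_approx_iff
  proof (intro conjI allI that)
    fix N
    obtain p where "p \<in> P (Suc N)" "dist p x \<le> 1 / real (Suc N)"
      using rationals_dense[of "Suc N" x] \<open>x \<in> F\<close> by auto
    then show "\<exists>q>N. \<exists>p\<in>P q. dist p x \<le> 1 / real q powr 1"
      by (intro exI[of _ "Suc N"]) auto
  qed
  then show ?thesis using well_approx_subset by blast
qed

text \<open>Packing with radii \<open>1 / (3 * q)\<close>. The radius 1/2 is chosen because 1/2 +
  1/3 = 5/6 stays below 1, where regularity applies, for every \<open>q \<ge> 1\<close>.\<close>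

lemma card_rationals:
  assumes "q \<ge> 1" "x \<in> F"
  shows "finite (P q \<inter> cball x (1/2))"
    and "real (card (P q \<inter> cball x (1/2))) \<le> C\<^sup>2 * 3 powr s * real q powr s"
proof -
  let ?K = "C\<^sup>2 * 3 powr s * real q powr s"
  \<comment> \<open>Packing concerns finite families, so finite subsets are bounded first; the
    uniform bound then gives finiteness of the whole set.\<close>
  have "card J \<le> nat \<lfloor>?K\<rfloor>" if J: "J \<subseteq> P q \<inter> cball x (1/2)" "finite J" for J
  proof -
    have "(\<Sum>j\<in>J. (1 / (3 * real q)) powr s) \<le> C\<^sup>2 * (5/6) powr s"
    proof (rule packing[where p = id and y = x])
      show "3 * (1 / (3 * real q)) \<le> dist (id i) (id j)" if "i \<in> J" "j \<in> J" "i \<noteq> j" for i j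
        using that J rationals_separated[OF assms(1), of i j] by auto
      show "dist x (id j) + 1 / (3 * real q) \<le> 5/6" if "j \<in> J" for j
      proof -
        have "dist x j \<le> 1/2" using that J by auto
        moreover have "1 / (3 * real q) \<le> 1/3" using assms(1) by (simp add: field_simps)
        ultimately show ?thesis by simp
      qed
    qed (use J assms rationals_subset[OF assms(1)] in auto)
    also have "\<dots> \<le> C\<^sup>2 * 1" by (intro mult_left_mono powr_le1) (use s_pos in auto)
    finally have "card J * (1 / (3 * real q)) powr s \<le> C\<^sup>2" by simp
    then have "real (card J) \<le> ?K"
      using assms(1) by (simp add: powr_divide powr_mult divide_le_eq mult_ac)
    then show ?thesis by (simp add: le_nat_floor)
  qed
  then have fin: "finite (P q \<inter> cball x (1/2)) \<and> card (P q \<inter> cball x (1/2)) \<le> nat \<lfloor>?K\<rfloor>"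
    by (intro finite_if_finite_subsets_card_bdd) auto
  then show "finite (P q \<inter> cball x (1/2))" by simp
  have "real (card (P q \<inter> cball x (1/2))) \<le> real (nat \<lfloor>?K\<rfloor>)"
    using fin by (simp only: of_nat_le_iff)
  also have "\<dots> \<le> ?K" by (rule of_nat_floor) simp
  finally show "real (card (P q \<inter> cball x (1/2))) \<le> ?K" .
qed

text \<open>A Borel-Cantelli argument: otherwise a ball is covered, up to a null set, by the levels
  beyond any \<open>M\<close>, whose total measure is the tail of a convergent series and falls
  below the lower regularity bound.\<close>

lemma full_measure_exponent_le:
  assumes "x \<in> F" "r > 0" and null: "hausdorff_measure s ((cball x r \<inter> F) - well_approx F P \<delta>) = 0"
  shows "\<delta> \<le> 1 + 1 / s"
proof (rule ccontr)
  assume "\<not> ?thesis"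
  then have "\<delta> > 1 + 1 / s" by simp
  then have "\<delta> * s > (1 + 1 / s) * s" using s_pos by (intro mult_strict_right_mono) auto
  then have \<delta>s: "s - \<delta> * s < -1" using s_pos by (simp add: algebra_simps)
  have "\<delta> > 1" using \<open>\<delta> > 1 + 1 / s\<close> s_pos by (smt (verit) divide_pos_pos)
  define \<rho> where "\<rho> q = 1 / real q powr \<delta>" for q
  have \<rho>: "0 < \<rho> q" "\<rho> q \<le> 1/4" if "q > 4" for q
  proof -
    have "real q powr 1 \<le> real q powr \<delta>" using that \<open>\<delta> > 1\<close> by (intro powr_mono) auto
    then have "4 \<le> real q powr \<delta>" using that by simp
    with that show "0 < \<rho> q" "\<rho> q \<le> 1/4" unfolding \<rho>_def
      using divide_left_mono[of 4 "real q powr \<delta>" 1] by auto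
  qed
  \<comment> \<open>With \<open>\<rho> q \<le> 1/4\<close>, a rational approximating a point of the
    ball of radius \<open>r'\<close> lies within 1/2 of \<open>x\<close>, where
    \<open>card_rationals\<close> counts.\<close>
  define r' where "r' = min r (1/4)"
  have r': "0 < r'" "r' \<le> r" "r' \<le> 1/4" using assms(2) by (auto simp: r'_def)
  define f where "f q = C\<^sup>2 * 3 powr s * C * real q powr (s - \<delta> * s)" for q :: nat
  have "summable f" unfolding f_def
    by (intro summable_mult) (use \<delta>s in \<open>simp add: summable_real_powr_iff\<close>)
  have "0 < r' powr s / C" using r' C_pos by simp
  from suminf_exist_split[OF this \<open>summable f\<close>]
  obtain N where N: "\<And>n. n \<ge> N \<Longrightarrow> norm (\<Sum>i. f (i + n)) < r' powr s / C"
    by blast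
  define M where "M = max N 5"
  let ?A = "\<lambda>q. \<Union>p\<in>P q \<inter> cball x (1/2). cball p (\<rho> q) \<inter> F"
  have A: "hausdorff_measure s (?A q) \<le> ennreal (f q)" if "q > 4" for q
  proof -
    have q: "q \<ge> 1" using that by simp
    have "hausdorff_measure s (?A q) \<le> (\<Sum>p\<in>P q \<inter> cball x (1/2). hausdorff_measure s (cball p (\<rho> q) \<inter> F))"
      by (rule hausdorff_measure_finite_UN_le[OF card_rationals(1)[OF q assms(1)]])
    also have "\<dots> \<le> (\<Sum>p\<in>P q \<inter> cball x (1/2). ennreal (C * \<rho> q powr s))"
      using rationals_subset[OF q] \<rho>[OF that] by (intro sum_mono upper) auto
    also have "\<dots> = ennreal (real (card (P q \<inter> cball x (1/2))) * (C * \<rho> q powr s))"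
      using C_pos by (simp add: ennreal_mult ennreal_of_nat_eq_real_of_nat)
    also have "\<dots> \<le> ennreal ((C\<^sup>2 * 3 powr s * real q powr s) * (C * \<rho> q powr s))"
      using C_pos card_rationals(2)[OF q assms(1)] by (intro ennreal_leI mult_right_mono) auto
    also have "(C\<^sup>2 * 3 powr s * real q powr s) * (C * \<rho> q powr s) = f q"
      using q by (simp add: f_def \<rho>_def powr_divide powr_powr powr_diff)
    finally show ?thesis .
  qed
  have "cball x r' \<inter> F \<subseteq> ((cball x r \<inter> F) - well_approx F P \<delta>) \<union> (\<Union>n. ?A (n + M))"
  proof
    fix y assume y: "y \<in> cball x r' \<inter> F"
    show "y \<in> ((cball x r \<inter> F) - well_approx F P \<delta>) \<union> (\<Union>n. ?A (n + M))"
    proof (cases "y \<in> well_approx F P \<delta>")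
      case True
      then obtain q p where q: "q > M" "p \<in> P q" "dist p y \<le> \<rho> q"
        unfolding well_approx_iff \<rho>_def by blast
      have "\<rho> q \<le> 1/4" using q by (intro \<rho>) (auto simp: M_def)
      then have "dist x p \<le> 1/2"
        using q y r' dist_triangle[of x p y] by (auto simp: dist_commute)
      with q y have "y \<in> ?A ((q - M) + M)" by auto
      then show ?thesis by blast
    qed (use y r' in auto)
  qed
  then have "hausdorff_measure s (cball x r' \<inter> F)
      \<le> hausdorff_measure s (((cball x r \<inter> F) - well_approx F P \<delta>) \<union> (\<Union>n. ?A (n + M)))"
    by (rule hausdorff_measure_mono)
  also have "\<dots> \<le> 0 + hausdorff_measure s (\<Union>n. ?A (n + M))"
    using hausdorff_measure_Un_le[of s "(cball x r \<inter> F) - well_approx F P \<delta>"] unfolding null .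
  also have "\<dots> \<le> (\<Sum>n. hausdorff_measure s (?A (n + M)))"
    unfolding add_0 by (rule hausdorff_measure_UN_le)
  also have "\<dots> \<le> (\<Sum>n. ennreal (f (n + M)))"
    using A[of "n + M" for n] by (intro suminf_le) (simp_all add: M_def)
  also have "\<dots> = ennreal (\<Sum>n. f (n + M))"
  proof (rule suminf_ennreal2)
    show "summable (\<lambda>n. f (n + M))" using \<open>summable f\<close> by (simp only: summable_iff_shift)
  qed (use C_pos in \<open>simp add: f_def\<close>)
  also have "\<dots> < ennreal (r' powr s / C)"
  proof (rule ennreal_lessI)
    have "N \<le> M" by (simp add: M_def)
    from N[OF this] show "(\<Sum>n. f (n + M)) < r' powr s / C" by simp
  qed fact
  finally show False using lower[OF assms(1), of r'] r' by simp
qed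

end

section \<open>Vitali selection of balls around rationals\<close>

lemma finite_maximal_separated:
  assumes "finite G"
  shows "\<exists>A. maximal_separated r G A"
proof -
  let ?X = "{A. A \<subseteq> G \<and> separated_by r A}"
  have "finite ?X" using assms by simp
  moreover have "?X \<noteq> {}" by (auto simp: separated_by_def)
  ultimately obtain A where A: "A \<in> ?X" "\<forall>B\<in>?X. A \<subseteq> B \<longrightarrow> A = B"
    using finite_has_maximal[of ?X] by blast
  have "\<not> separated_by r (insert x A)" if "x \<in> G - A" for x
    using A(1) A(2)[rule_format, of "insert x A"] that by auto
  with A(1) show ?thesis by (auto simp: maximal_separated_def)
qed

text \<open>Level by level, discard the candidates too close to earlier choices and take a maximal
  separated subset of the rest. Whatever is not chosen is then close to a chosen point of the same
  or an earlier level, as in Vitali's covering lemma.\<close>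

lemma greedy_selection:
  fixes G :: "nat \<Rightarrow> 'a::metric_space set" and w :: "nat \<Rightarrow> real"
  assumes "\<And>q. finite (G q)" and w: "\<And>q. 0 \<le> w q"
  obtains S where "\<And>q. S q \<subseteq> G q"
    and "\<And>q a b. \<lbrakk>a \<in> S q; b \<in> S q; a \<noteq> b\<rbrakk> \<Longrightarrow> w q \<le> dist a b"
    and "\<And>q q' a b. \<lbrakk>q' < q; a \<in> S q'; b \<in> S q\<rbrakk> \<Longrightarrow> w q' \<le> dist a b"
    and "\<And>q b. b \<in> G q \<Longrightarrow> \<exists>q'\<le>q. \<exists>a\<in>S q'. dist a b \<le> w q'"
proof -
  define H where "H f q = {b \<in> G q. \<forall>q'<q. \<forall>a\<in>f q'. w q' \<le> dist a b}" for f :: "nat \<Rightarrow> 'a set" and q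
  have "\<exists>S. \<forall>q. maximal_separated (w q) (H S q) (S q)"
  \<comment> \<open>The candidates at level \<open>q\<close> depend only on the selections at
    smaller levels, so the recursion is well founded.\<close>
  proof (rule dependent_wellorder_choice)
    fix r and f g :: "nat \<Rightarrow> 'a set" and q assume "\<And>y. y < q \<Longrightarrow> f y = g y"
    then have "H f q = H g q" by (auto simp: H_def)
    then show "maximal_separated (w q) (H f q) r = maximal_separated (w q) (H g q) r" by simp
  next
    fix q and f :: "nat \<Rightarrow> 'a set"
    show "\<exists>r. maximal_separated (w q) (H f q) r"
      by (intro finite_maximal_separated) (use assms(1) in \<open>auto simp: H_def\<close>)
  qed
  then obtain S where S: "\<And>q. maximal_separated (w q) (H S q) (S q)" by blast
  then have sub: "S q \<subseteq> H S q" and sep: "separated_by (w q) (S q)" for q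
    by (auto simp: maximal_separated_def)
  show ?thesis
  proof
    show "S q \<subseteq> G q" for q using sub[of q] by (auto simp: H_def)
    show "w q \<le> dist a b" if "a \<in> S q" "b \<in> S q" "a \<noteq> b" for q a b
      using sep[of q] that by (auto simp: separated_by_def)
    show "w q' \<le> dist a b" if "q' < q" "a \<in> S q'" "b \<in> S q" for q q' a b
      using sub[of q] that by (auto simp: H_def)
    show "\<exists>q'\<le>q. \<exists>a\<in>S q'. dist a b \<le> w q'" if b: "b \<in> G q" for q b
    proof (cases "b \<in> H S q - S q")
      case True
      with S have "\<not> separated_by (w q) (insert b (S q))" by (auto simp: maximal_separated_def)
      with sep[of q] obtain a where "a \<in> S q" "dist a b < w q"
        by (auto simp: separated_by_def dist_commute not_le)
      then show ?thesis by (intro exI[of _ q]) (auto intro: less_imp_le)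
    next
      case False
      show ?thesis
      proof (cases "b \<in> S q")
        case True
        then show ?thesis using w[of q] by (intro exI[of _ q]) (auto intro!: bexI[of _ b])
      next
        case False
        with \<open>b \<notin> H S q - S q\<close> b obtain q' a where "q' < q" "a \<in> S q'" "dist a b < w q'"
          by (auto simp: H_def not_le)
        then show ?thesis by (intro exI[of _ q']) (auto intro: less_imp_le)
      qed
    qed
  qed
qed

lemma inverse_powr_small:
  fixes a e :: real
  assumes "a > 0" "e > 0"
  obtains N where "N \<ge> N0" "\<And>q. q > N \<Longrightarrow> 1 / real q powr a \<le> e"
proof -
  have "((\<lambda>q. real q powr (-a)) \<longlongrightarrow> 0) sequentially"
    using assms by (intro tendsto_neg_powr filterlim_real_sequentially) auto
  then have "eventually (\<lambda>q. real q powr (-a) < e) sequentially"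
    using assms(2) by (rule order_tendstoD)
  then obtain N where N: "\<And>q. q \<ge> N \<Longrightarrow> real q powr (-a) < e"
    by (auto simp: eventually_sequentially)
  show ?thesis
  proof (rule that[of "max N N0"])
    fix q assume "q > max N N0"
    then show "1 / real q powr a \<le> e" using N[of q] by (simp add: powr_minus_divide)
  qed simp
qed

text \<open>The sets hitting \<open>B\<close> weigh together no more than a single set of diameter
  \<open>c\<close>, where \<open>d i\<close> stands for the diameter of \<open>U i\<close>. Bounding
  finite partial sums avoids any question of convergence.\<close>

definition sparse_cover :: "('i \<Rightarrow> 'a set) \<Rightarrow> ('i \<Rightarrow> real) \<Rightarrow> real \<Rightarrow> real \<Rightarrow> 'a set \<Rightarrow> bool" where
  "sparse_cover U d v c B \<longleftrightarrow>
     (\<forall>S. finite S \<and> (\<forall>i\<in>S. U i \<inter> B \<noteq> {}) \<longrightarrow> (\<Sum>i\<in>S. d i powr v) \<le> c powr v)"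

text \<open>A one-element sum. It bounds the sets that hit a ball by the size of the ball, and it
  excludes the limit point from the cover at the end.\<close>

lemma sparse_cover_single:
  assumes "sparse_cover U d v c B" "0 < v" "0 \<le> c" "U i \<inter> B \<noteq> {}"
  shows "d i \<le> c"
proof -
  have "d i powr v \<le> c powr v"
    using assms(1,4) unfolding sparse_cover_def by (auto dest: spec[of _ "{i}"])
  then show ?thesis using assms(2,3) by (meson not_le powr_less_mono2)
qed

context ad_regular_rationals
begin

text \<open>Choosing greedily with separation \<open>3 * \<rho> q\<close>, the balls enlarged four
  times cover almost all of the ball of radius \<open>r/2\<close>. The factors 2 for halving the
  radius and 4 for the enlargement combine to \<open>8 powr s\<close>.\<close>

lemma ball_selection:
  assumes x: "x \<in> F" and r: "0 < r" "r \<le> 1/2" and "\<delta> > 0"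
    and null: "hausdorff_measure s ((cball x r \<inter> F) - well_approx F P \<delta>) = 0"
  obtains J where "finite J"
    "\<And>q p. (q, p) \<in> J \<Longrightarrow> q > N \<and> p \<in> P q \<and> dist x p + 2 / real q powr \<delta> \<le> r"
    "\<And>q p q' p'. \<lbrakk>(q, p) \<in> J; (q', p') \<in> J; (q, p) \<noteq> (q', p')\<rbrakk> \<Longrightarrow> 3 / real q powr \<delta> \<le> dist p p'"
    "r powr s / (2 * C\<^sup>2 * 8 powr s) < (\<Sum>(q, p)\<in>J. (1 / real q powr \<delta>) powr s)"
proof -
  define \<rho> where "\<rho> q = 1 / real q powr \<delta>" for q :: nat
  \<comment> \<open>The bound r/8 serves three ends: relevant centres lie within r/2 + r/8 \<le>
    3r/4 of \<open>x\<close>, doubled balls around them stay inside since 3r/4 + 2r/8 = r, and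
    enlarged radii are at most r/2 < 1.\<close>
  obtain M where M: "M \<ge> N + 1" and small: "\<And>q. q > M \<Longrightarrow> \<rho> q \<le> r / 8"
    using inverse_powr_small[of \<delta> "r / 8" "N + 1"] r \<open>\<delta> > 0\<close> unfolding \<rho>_def by auto
  have \<rho>_nonneg: "\<rho> q \<ge> 0" for q by (simp add: \<rho>_def)
  have \<rho>_mono: "\<rho> q \<le> \<rho> q'" if "q' \<le> q" "q' > 0" for q q'
    unfolding \<rho>_def using that \<open>\<delta> > 0\<close> by (intro divide_left_mono powr_mono2) auto
  define G where "G q = (if q > M then {p \<in> P q. dist x p \<le> 3 * r / 4} else {})" for q
  have G: "q > M" "p \<in> P q" "dist x p \<le> 3 * r / 4" if "p \<in> G q" for p q
    using that by (auto simp: G_def split: if_splits)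
  have finG: "finite (G q)" for q
  proof (cases "q > M")
    case True
    have "G q \<subseteq> P q \<inter> cball x (1/2)" using G[of _ q] r by fastforce
    then show ?thesis by (rule finite_subset) (use True x in \<open>intro card_rationals(1); simp\<close>)
  qed (simp add: G_def)
  have w: "0 \<le> 3 * \<rho> q" for q using \<rho>_nonneg[of q] by simp
  obtain S where S: "\<And>q. S q \<subseteq> G q"
    and sep: "\<And>q a b. \<lbrakk>a \<in> S q; b \<in> S q; a \<noteq> b\<rbrakk> \<Longrightarrow> 3 * \<rho> q \<le> dist a b"
    and sep': "\<And>q q' a b. \<lbrakk>q' < q; a \<in> S q'; b \<in> S q\<rbrakk> \<Longrightarrow> 3 * \<rho> q' \<le> dist a b"
    and meet: "\<And>q b. b \<in> G q \<Longrightarrow> \<exists>q'\<le>q. \<exists>a\<in>S q'. dist a b \<le> 3 * \<rho> q'"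
    by (rule greedy_selection[of G "\<lambda>q. 3 * \<rho> q", OF finG w]) (rule that)
  have finS: "finite (S q)" for q using finite_subset[OF S finG] .
  let ?A = "\<lambda>q. \<Union>p\<in>S q. cball p (4 * \<rho> q) \<inter> F"
  have A: "hausdorff_measure s (?A q) \<le> ennreal (card (S q) * (C * (4 * \<rho> q) powr s))" for q
  proof -
    have "hausdorff_measure s (?A q) \<le> (\<Sum>p\<in>S q. hausdorff_measure s (cball p (4 * \<rho> q) \<inter> F))"
      by (rule hausdorff_measure_finite_UN_le[OF finS])
    also have "\<dots> \<le> (\<Sum>p\<in>S q. ennreal (C * (4 * \<rho> q) powr s))"
    proof (intro sum_mono upper)
      fix p assume "p \<in> S q"
      then have "q > M" "p \<in> P q" using S[of q] G by auto
      then show "p \<in> F" "0 < 4 * \<rho> q" "4 * \<rho> q < 1"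
        using rationals_subset[of q] small[of q] r by (auto simp: \<rho>_def[of q] simp del: times_divide_eq_right)
    qed
    also have "\<dots> = ennreal (card (S q) * (C * (4 * \<rho> q) powr s))"
      using C_pos by (simp add: ennreal_mult ennreal_of_nat_eq_real_of_nat)
    finally show ?thesis .
  qed
  have "cball x (r/2) \<inter> F \<subseteq> ((cball x r \<inter> F) - well_approx F P \<delta>) \<union> (\<Union>q. ?A q)"
  proof
    fix y assume y: "y \<in> cball x (r/2) \<inter> F"
    show "y \<in> ((cball x r \<inter> F) - well_approx F P \<delta>) \<union> (\<Union>q. ?A q)"
    proof (cases "y \<in> well_approx F P \<delta>")
      case True
      then obtain q p where q: "q > M" "p \<in> P q" "dist p y \<le> \<rho> q"
        unfolding well_approx_iff \<rho>_def by blast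
      have "dist x p \<le> r/2 + r/8"
        using q(3) small[OF q(1)] y dist_triangle[of x p y] by (auto simp: dist_commute)
      with q r have "p \<in> G q" by (simp add: G_def)
      then obtain q' a where a: "q' \<le> q" "a \<in> S q'" "dist a p \<le> 3 * \<rho> q'" using meet by blast
      have "q' > M" using S[of q'] a(2) G by blast
      then have "\<rho> q \<le> \<rho> q'" using a(1) by (intro \<rho>_mono) auto
      \<comment> \<open>The chosen ball has the smaller denominator, hence the larger radius: 3 + 1
        multiples of it reach \<open>y\<close>.\<close>
      then have "dist a y \<le> 4 * \<rho> q'" using a(3) q(3) dist_triangle[of a y p] by linarith
      with a(2) y show ?thesis by auto
    qed (use y r in auto)
  qed
  then have "hausdorff_measure s (cball x (r/2) \<inter> F)
      \<le> hausdorff_measure s (((cball x r \<inter> F) - well_approx F P \<delta>) \<union> (\<Union>q. ?A q))"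
    by (rule hausdorff_measure_mono)
  also have "\<dots> \<le> 0 + hausdorff_measure s (\<Union>q. ?A q)"
    using hausdorff_measure_Un_le[of s "(cball x r \<inter> F) - well_approx F P \<delta>"] unfolding null .
  also have "\<dots> \<le> (\<Sum>q. hausdorff_measure s (?A q))"
    unfolding add_0 by (rule hausdorff_measure_UN_le)
  also have "\<dots> \<le> (\<Sum>q. ennreal (card (S q) * (C * (4 * \<rho> q) powr s)))"
    using A by (intro suminf_le) simp_all
  finally have "hausdorff_measure s (cball x (r/2) \<inter> F)
      \<le> (\<Sum>q. ennreal (card (S q) * (C * (4 * \<rho> q) powr s)))" .
  \<comment> \<open>Giving away a factor 2 makes the inequality strict, so a finite partial sum of
    the series already exceeds the bound.\<close>
  moreover have "ennreal ((r/2) powr s / (2 * C)) < ennreal ((r/2) powr s / C)"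
    using r C_pos by (intro ennreal_lessI) (auto simp: field_simps)
  moreover have "ennreal ((r/2) powr s / C) \<le> hausdorff_measure s (cball x (r/2) \<inter> F)"
    by (rule lower[OF x]) (use r in auto)
  ultimately have "ennreal ((r/2) powr s / (2 * C)) < (\<Sum>q. ennreal (card (S q) * (C * (4 * \<rho> q) powr s)))"
    by order
  then obtain n where "ennreal ((r/2) powr s / (2 * C)) < (\<Sum>q<n. ennreal (card (S q) * (C * (4 * \<rho> q) powr s)))"
    unfolding suminf_eq_SUP less_SUP_iff by blast
  also have "\<dots> = ennreal (\<Sum>q<n. card (S q) * (C * (4 * \<rho> q) powr s))"
    using C_pos by (intro sum_ennreal) auto
  finally have "(r/2) powr s / (2 * C) < (\<Sum>q<n. card (S q) * (C * (4 * \<rho> q) powr s))"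
    by (subst (asm) ennreal_less_iff) (use C_pos in auto)
  also have "\<dots> = C * 4 powr s * (\<Sum>q<n. card (S q) * \<rho> q powr s)"
    using \<rho>_nonneg by (simp add: sum_distrib_left powr_mult mult_ac)
  finally have less: "(r/2) powr s / (2 * C) < C * 4 powr s * (\<Sum>q<n. card (S q) * \<rho> q powr s)" .
  define J where "J = Sigma {..<n} S"
  show ?thesis
  proof
    show "finite J" using finS by (auto simp: J_def)
    show "q > N \<and> p \<in> P q \<and> dist x p + 2 / real q powr \<delta> \<le> r" if "(q, p) \<in> J" for q p
    proof -
      have "p \<in> G q" using that S[of q] by (auto simp: J_def)
      from G[OF this] small[of q] M show ?thesis by (auto simp: \<rho>_def)
    qed
    show "3 / real q powr \<delta> \<le> dist p p'"
      if J: "(q, p) \<in> J" "(q', p') \<in> J" and ne: "(q, p) \<noteq> (q', p')" for q p q' p'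
    proof -
      have p: "p \<in> S q" "p' \<in> S q'" using J by (auto simp: J_def)
      consider "q < q'" | "q = q'" | "q' < q" by linarith
      then have "3 * \<rho> q \<le> dist p p'"
      proof cases
        case 3
        have "q' > M" using p(2) S[of q'] G by blast
        then have "\<rho> q \<le> \<rho> q'" using 3 by (intro \<rho>_mono) auto
        with sep'[OF 3 p(2,1)] show ?thesis by (simp add: dist_commute)
      qed (use p sep sep' ne in auto)
      then show ?thesis by (simp add: \<rho>_def)
    qed
    have "r powr s / (2 * C\<^sup>2 * 8 powr s) = ((r/2) powr s / (2 * C)) / (C * 4 powr s)"
      using r C_pos powr_mult[of 2 4 s] by (simp add: powr_divide power2_eq_square)
    also have "\<dots> < (\<Sum>q<n. card (S q) * \<rho> q powr s)"
      using less C_pos by (simp add: divide_less_eq mult_ac)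
    also have "\<dots> = (\<Sum>(q, p)\<in>J. \<rho> q powr s)"
      unfolding J_def by (subst sum.Sigma[symmetric]) (use finS in auto)
    finally show "r powr s / (2 * C\<^sup>2 * 8 powr s) < (\<Sum>(q, p)\<in>J. (1 / real q powr \<delta>) powr s)"
      by (simp add: \<rho>_def)
  qed
qed

end

section \<open>Avoiding a cover of small total weight\<close>

context ad_regular_rationals
begin

text \<open>The inductive step of the nested construction. The condition on \<theta> limits the loss
  to large covering sets to half of the selected weight; the slack
  \<open>\<delta> * s - v * t\<close> makes the allowances of the remaining balls outweigh the
  cover.\<close>

lemma avoidance_step:
  fixes U :: "'i \<Rightarrow> 'a set" and d :: "'i \<Rightarrow> real"
  assumes x: "x \<in> F" and r: "0 < r" "r \<le> 1/2"
    and \<delta>: "0 < \<delta>" "\<delta> \<le> t" and v: "0 < v" "v * t < \<delta> * s"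
    and null: "hausdorff_measure s ((cball x r \<inter> F) - well_approx F P \<delta>) = 0"
    and d: "\<And>i. 0 < d i" "\<And>i a b. \<lbrakk>a \<in> U i; b \<in> U i\<rbrakk> \<Longrightarrow> dist a b \<le> d i"
    and \<theta>: "0 < \<theta>" "\<theta> \<le> 1/4" "C\<^sup>2 * 4 powr s * \<theta> powr s \<le> 1 / (4 * C\<^sup>2 * 8 powr s)"
    and sparse: "sparse_cover U d v (\<theta> * r) (cball x r)"
  shows "\<exists>q>N. \<exists>p\<in>P q. 1 / real q powr t \<le> r \<and> cball p (1 / real q powr t) \<subseteq> cball x r \<and>
           sparse_cover U d v (\<theta> * (1 / real q powr t)) (cball p (1 / real q powr t))"
proof -
  define c where "c = 1 / (2 * C\<^sup>2 * 8 powr s)"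
  have c: "c > 0" using C_pos by (simp add: c_def)
  define \<kappa> where "\<kappa> = \<delta> * s - v * t"
  \<comment> \<open>Chosen so that the allowances of the surviving balls exceed twice the weight
    \<open>(\<theta> * r) powr v\<close> available in the large ball.\<close>
  define e where "e = c * r powr s / (4 * r powr v)"
  have "\<kappa> > 0" "e > 0" using v c r by (auto simp: \<kappa>_def e_def)
  then obtain M where M: "M \<ge> N" "\<And>q. q > M \<Longrightarrow> 1 / real q powr \<kappa> \<le> e"
    using inverse_powr_small by blast
  obtain J where J: "finite J"
    and J_ball: "\<And>q p. (q, p) \<in> J \<Longrightarrow> q > M \<and> p \<in> P q \<and> dist x p + 2 / real q powr \<delta> \<le> r"
    and J_sep: "\<And>q p q' p'. \<lbrakk>(q, p) \<in> J; (q', p') \<in> J; (q, p) \<noteq> (q', p')\<rbrakk> \<Longrightarrow> 3 / real q powr \<delta> \<le> dist p p'"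
    and J_sum: "r powr s / (2 * C\<^sup>2 * 8 powr s) < (\<Sum>(q, p)\<in>J. (1 / real q powr \<delta>) powr s)"
    by (rule ball_selection[OF x r \<delta>(1) null]) (rule that)
  define \<rho> where "\<rho> z = 1 / real (fst z) powr \<delta>" for z :: "nat \<times> 'a"
  define \<rho>' where "\<rho>' z = 1 / real (fst z) powr t" for z :: "nat \<times> 'a"
  have z: "fst z > M" "snd z \<in> P (fst z)" "snd z \<in> F" "dist x (snd z) + 2 * \<rho> z \<le> r"
    "0 < \<rho> z" "0 < \<rho>' z" "\<rho>' z \<le> \<rho> z" if "z \<in> J" for z
  proof -
    have *: "fst z > M" "snd z \<in> P (fst z)" "dist x (snd z) + 2 * \<rho> z \<le> r"
      using J_ball[of "fst z" "snd z"] that by (auto simp: \<rho>_def)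
    then show "fst z > M" "snd z \<in> P (fst z)" "snd z \<in> F" "dist x (snd z) + 2 * \<rho> z \<le> r"
      using rationals_subset[of "fst z"] by auto
    show "0 < \<rho> z" "0 < \<rho>' z" using *(1) by (auto simp: \<rho>_def \<rho>'_def)
    show "\<rho>' z \<le> \<rho> z" unfolding \<rho>_def \<rho>'_def
      using *(1) \<delta> by (intro divide_left_mono powr_mono mult_pos_pos) auto
  qed
  have sep: "3 * \<rho> z \<le> dist (snd z) (snd z')" if "z \<in> J" "z' \<in> J" "z \<noteq> z'" for z z'
    using J_sep[of "fst z" "snd z" "fst z'" "snd z'"] that by (simp add: \<rho>_def)
  define A where "A z = cball (snd z) (\<rho>' z)" for z :: "nat \<times> 'a"
  have A_sub: "A z \<subseteq> cball x r" if "z \<in> J" for z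
  proof
    fix y assume "y \<in> A z"
    then have "dist (snd z) y \<le> \<rho>' z" by (simp add: A_def)
    with z[OF that] dist_triangle[of x y "snd z"] show "y \<in> cball x r" by auto
  qed
  \<comment> \<open>Used twice: if \<open>d i\<close> is at least both radii, the centres cluster at
    scale \<open>d i\<close>; if it is smaller than both, the separation is contradicted.\<close>
  have close: "dist (snd z) (snd z') \<le> \<rho> z + d i + \<rho> z'"
    if "z \<in> J" "z' \<in> J" "U i \<inter> A z \<noteq> {}" "U i \<inter> A z' \<noteq> {}" for z z' i
  proof -
    obtain a b where ab: "a \<in> U i" "a \<in> A z" "b \<in> U i" "b \<in> A z'" using \<open>U i \<inter> A z \<noteq> {}\<close> \<open>U i \<inter> A z' \<noteq> {}\<close> by blast
    have "dist (snd z) a \<le> \<rho> z" "dist (snd z') b \<le> \<rho> z'"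
      using ab z(7)[OF \<open>z \<in> J\<close>] z(7)[OF \<open>z' \<in> J\<close>] by (auto simp: A_def)
    moreover have "dist (snd z) (snd z') \<le> dist (snd z) a + dist a b + dist (snd z') b"
      using dist_triangle[of "snd z" "snd z'" a] dist_triangle[of a "snd z'" b] by (simp add: dist_commute)
    ultimately show ?thesis using d(2)[OF ab(1,3)] by linarith
  qed
  txt \<open>
    The centres in \<open>K\<close> are lost: their ball is hit by a covering set at least as large as the
    selected ball. By packing their total weight is at most half of the weight of \<open>J\<close>.
  \<close>
  define K where "K = {z \<in> J. \<exists>i. U i \<inter> A z \<noteq> {} \<and> \<rho> z \<le> d i}"
  have K: "finite K" "K \<subseteq> J" using J by (auto simp: K_def)
  have killed: "(\<Sum>z\<in>K. \<rho> z powr s) \<le> c / 2 * r powr s"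
  proof -
    have "\<forall>z\<in>K. \<exists>i. U i \<inter> A z \<noteq> {} \<and> \<rho> z \<le> d i" by (auto simp: K_def)
    then obtain \<iota> where \<iota>: "\<And>z. z \<in> K \<Longrightarrow> U (\<iota> z) \<inter> A z \<noteq> {} \<and> \<rho> z \<le> d (\<iota> z)" by metis
    let ?D = "C\<^sup>2 * 4 powr s * (\<theta> * r) powr (s - v)"
    \<comment> \<open>This lets \<open>d i powr s\<close> be traded for
      \<open>(\<theta> * r) powr (s - v) * d i powr v\<close>, turning the packing bound into one in
      terms of the cover's weight.\<close>
    have "v < s"
    proof -
      have "v * t < t * s" using v(2) mult_right_mono[OF \<delta>(2), of s] s_pos by linarith
      then show ?thesis using \<delta> by (simp add: mult.commute)
    qed
    have hit: "U (\<iota> z) \<inter> cball x r \<noteq> {}" if "z \<in> K" for z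
      using \<iota>[OF that] A_sub[of z] K that by blast
    \<comment> \<open>All balls lost to the same set \<open>U i\<close> lie within
      \<open>4 * d i\<close> of one of their centres, so packing applies; sparseness gives
      \<open>d i \<le> 1/8\<close> and thus a radius below 1.\<close>
    have each: "(\<Sum>z\<in>{z\<in>K. \<iota> z = i}. \<rho> z powr s) \<le> ?D * d i powr v" if i: "i \<in> \<iota> ` K" for i
    proof -
      obtain z0 where z0: "z0 \<in> K" "\<iota> z0 = i" using i by auto
      have di: "d i \<le> \<theta> * r"
        using sparse_cover_single[OF sparse v(1)] hit[OF z0(1)] \<theta> r z0 by simp
      also have "\<dots> \<le> 1/4 * (1/2)" using \<theta> r by (intro mult_mono) auto
      finally have "4 * d i < 1" by simp
      have "(\<Sum>z\<in>{z\<in>K. \<iota> z = i}. \<rho> z powr s) \<le> C\<^sup>2 * (4 * d i) powr s"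
      proof (rule packing[where p = snd and y = "snd z0"])
        show "dist (snd z0) (snd z) + \<rho> z \<le> 4 * d i" if "z \<in> {z\<in>K. \<iota> z = i}" for z
        proof -
          have J: "z0 \<in> J" "z \<in> J" and K: "z0 \<in> K" "z \<in> K" using that z0 K by auto
          have "dist (snd z0) (snd z) \<le> \<rho> z0 + d i + \<rho> z"
            using \<iota>[OF K(1)] \<iota>[OF K(2)] that z0 by (intro close J) auto
          moreover have "\<rho> z0 \<le> d i" "\<rho> z \<le> d i"
            using \<iota>[OF K(1)] \<iota>[OF K(2)] that z0 by auto
          ultimately show ?thesis by linarith
        qed
        show "3 * \<rho> z \<le> dist (snd z) (snd z')"
          if "z \<in> {z\<in>K. \<iota> z = i}" "z' \<in> {z\<in>K. \<iota> z = i}" "z \<noteq> z'" for z z'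
          using that K by (intro sep) blast+
        show "snd z \<in> F" "0 < \<rho> z" if "z \<in> {z\<in>K. \<iota> z = i}" for z
          using that K z(3,5)[of z] by auto
        show "snd z0 \<in> F" using z0(1) K z(3)[of z0] by auto
      qed (use K(1) d(1)[of i] \<open>4 * d i < 1\<close> in auto)
      also have "\<dots> = C\<^sup>2 * 4 powr s * (d i powr (s - v) * d i powr v)"
        using d(1)[of i] by (simp add: powr_mult powr_add[symmetric])
      also have "\<dots> \<le> C\<^sup>2 * 4 powr s * ((\<theta> * r) powr (s - v) * d i powr v)"
        using di d(1)[of i] \<open>v < s\<close> by (intro mult_left_mono mult_right_mono powr_mono2) auto
      finally show ?thesis by (simp add: mult_ac)
    qed
    have "(\<Sum>z\<in>K. \<rho> z powr s) = (\<Sum>i\<in>\<iota> ` K. \<Sum>z\<in>{z\<in>K. \<iota> z = i}. \<rho> z powr s)"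
      by (rule sum.image_gen[OF K(1)])
    also have "\<dots> \<le> (\<Sum>i\<in>\<iota> ` K. ?D * d i powr v)" by (rule sum_mono[OF each])
    also have "\<dots> = ?D * (\<Sum>i\<in>\<iota> ` K. d i powr v)" by (simp only: sum_distrib_left)
    also have "\<dots> \<le> ?D * (\<theta> * r) powr v"
      using sparse hit K(1) unfolding sparse_cover_def by (intro mult_left_mono) auto
    also have "\<dots> = C\<^sup>2 * 4 powr s * (\<theta> * r) powr s"
      by (simp only: mult.assoc powr_add[symmetric] diff_add_cancel)
    also have "\<dots> = C\<^sup>2 * 4 powr s * \<theta> powr s * r powr s"
      using \<theta> r by (simp add: powr_mult)
    also have "\<dots> \<le> c / 2 * r powr s"
      using \<theta>(3) by (intro mult_right_mono) (auto simp: c_def)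
    finally show ?thesis .
  qed
  define L where "L = J - K"
  have L: "finite L" "L \<subseteq> J" using J by (auto simp: L_def)
  have "(\<Sum>z\<in>J. \<rho> z powr s) > c * r powr s"
    using J_sum by (simp add: \<rho>_def c_def case_prod_unfold)
  moreover have "(\<Sum>z\<in>J. \<rho> z powr s) = (\<Sum>z\<in>L. \<rho> z powr s) + (\<Sum>z\<in>K. \<rho> z powr s)"
    unfolding L_def by (rule sum.subset_diff[OF K(2) J])
  ultimately have L_sum: "c / 2 * r powr s < (\<Sum>z\<in>L. \<rho> z powr s)"
    using killed by simp
  txt \<open>
    A covering set hitting the ball of some \<open>z \<in> L\<close> is smaller than \<open>\<rho> z\<close>, so it hits the ball of no
    other member of \<open>L\<close>; if sparseness failed throughout \<open>L\<close>, adding up the violations would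
    contradict the sparseness on \<open>cball x r\<close>.
  \<close>
  have "\<exists>z\<in>L. sparse_cover U d v (\<theta> * \<rho>' z) (A z)"
  proof (rule ccontr)
    assume "\<not> ?thesis"
    then have "\<forall>z\<in>L. \<exists>S. finite S \<and> (\<forall>i\<in>S. U i \<inter> A z \<noteq> {}) \<and> (\<theta> * \<rho>' z) powr v < (\<Sum>i\<in>S. d i powr v)"
      by (auto simp: sparse_cover_def not_le)
    then obtain S where S: "\<And>z. z \<in> L \<Longrightarrow> finite (S z)"
        "\<And>z i. \<lbrakk>z \<in> L; i \<in> S z\<rbrakk> \<Longrightarrow> U i \<inter> A z \<noteq> {}"
        "\<And>z. z \<in> L \<Longrightarrow> (\<theta> * \<rho>' z) powr v < (\<Sum>i\<in>S z. d i powr v)"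
      by metis
    have small: "d i < \<rho> z" if "z \<in> L" "i \<in> S z" for z i
      using S(2)[OF that] that(1) by (force simp: L_def K_def)
    have disj: "S z \<inter> S z' = {}" if zz: "z \<in> L" "z' \<in> L" "z \<noteq> z'" for z z'
    proof (rule ccontr)
      assume "S z \<inter> S z' \<noteq> {}"
      then obtain i where i: "i \<in> S z" "i \<in> S z'" by blast
      have J: "z \<in> J" "z' \<in> J" using zz L by auto
      have "dist (snd z) (snd z') \<le> \<rho> z + d i + \<rho> z'"
        using zz i J by (intro close S(2)) auto
      with sep[OF J zz(3)] sep[OF J(2,1)] zz(3) small[OF zz(1) i(1)] small[OF zz(2) i(2)]
      show False by (simp add: dist_commute)
    qed
    \<comment> \<open>With q the denominator, \<open>\<rho> z powr s\<close> is
      \<open>\<rho>' z powr v\<close> times \<open>1 / q powr \<kappa>\<close>, and the last factor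
      is at most \<open>e\<close> beyond \<open>M\<close>.\<close>
    have weight: "\<theta> powr v / e * \<rho> z powr s \<le> (\<theta> * \<rho>' z) powr v" if "z \<in> L" for z
    proof -
      have q: "fst z > M" using that L z by blast
      have "\<rho> z powr s = 1 / real (fst z) powr (\<delta> * s)"
        by (simp add: \<rho>_def powr_divide powr_powr)
      also have "\<dots> = 1 / real (fst z) powr (\<kappa> + v * t)" by (simp add: \<kappa>_def)
      also have "\<dots> = 1 / real (fst z) powr \<kappa> * (1 / real (fst z) powr (t * v))"
        by (simp add: powr_add mult.commute)
      also have "1 / real (fst z) powr (t * v) = \<rho>' z powr v"
        by (simp add: \<rho>'_def powr_divide powr_powr)
      also have "1 / real (fst z) powr \<kappa> * \<rho>' z powr v \<le> e * \<rho>' z powr v"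
        by (intro mult_right_mono M(2) q) simp
      finally have "\<theta> powr v / e * \<rho> z powr s \<le> \<theta> powr v / e * (e * \<rho>' z powr v)"
        using \<open>e > 0\<close> by (intro mult_left_mono) auto
      also have "\<dots> = (\<theta> * \<rho>' z) powr v"
        using \<open>e > 0\<close> \<theta> z(6)[of z] that L by (simp add: powr_mult)
      finally show ?thesis .
    qed
    have "\<theta> powr v / e * (c / 2 * r powr s) < \<theta> powr v / e * (\<Sum>z\<in>L. \<rho> z powr s)"
      using L_sum \<theta> \<open>e > 0\<close> by (intro mult_strict_left_mono) auto
    also have "\<dots> \<le> (\<Sum>z\<in>L. (\<theta> * \<rho>' z) powr v)"
      unfolding sum_distrib_left by (rule sum_mono[OF weight])
    also have "\<dots> \<le> (\<Sum>z\<in>L. \<Sum>i\<in>S z. d i powr v)"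
      by (intro sum_mono less_imp_le S(3))
    also have "\<dots> = (\<Sum>i\<in>(\<Union>z\<in>L. S z). d i powr v)"
      by (rule sum.UNION_disjoint[symmetric]) (use L S disj in auto)
    also have "\<dots> \<le> (\<theta> * r) powr v"
    proof -
      have "finite (\<Union>z\<in>L. S z)" using L S by auto
      moreover have "U i \<inter> cball x r \<noteq> {}" if "i \<in> (\<Union>z\<in>L. S z)" for i
        using that S(2) A_sub L by blast
      ultimately show ?thesis using sparse unfolding sparse_cover_def by blast
    qed
    also have "\<dots> = \<theta> powr v * r powr v" using \<theta> r by (simp add: powr_mult)
    also have "\<theta> powr v / e * (c / 2 * r powr s) = 2 * (\<theta> powr v * r powr v)"
      using c r by (simp add: e_def field_simps)
    finally show False using \<theta> r by simp
  qed
  then obtain w where w: "w \<in> J" "sparse_cover U d v (\<theta> * \<rho>' w) (A w)" using L by blast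
  have "\<rho>' w \<le> r" using z[OF w(1)] zero_le_dist[of x "snd w"] by linarith
  then show ?thesis
    using z[OF w(1)] w A_sub[OF w(1)] M(1)
    by (intro exI[of _ "fst w"]) (auto simp: A_def \<rho>'_def intro!: bexI[of _ "snd w"])
qed

end

text \<open>
  The \<open>d i\<close> are strictly positive upper bounds of the diameters, so that a point lying in \<open>U i\<close> is
  eventually excluded by the sparseness bound even if \<open>U i\<close> is a singleton.
\<close>

lemma null_imp_small_cover:
  fixes A :: "'a::metric_space set"
  assumes null: "hausdorff_measure u A = 0" and uv: "0 \<le> u" "u < v" and "0 < \<epsilon>"
  obtains U :: "nat \<Rightarrow> 'a set" and d :: "nat \<Rightarrow> real" where "A \<subseteq> (\<Union>i. U i)" "\<And>i. 0 < d i"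
    "\<And>i a b. \<lbrakk>a \<in> U i; b \<in> U i\<rbrakk> \<Longrightarrow> dist a b \<le> d i"
    "\<And>S. finite S \<Longrightarrow> (\<Sum>i\<in>S. d i powr v) \<le> \<epsilon>"
proof -
  \<comment> \<open>Scale 1 suffices: diameters at most 1 allow the exponent to be raised from
    \<open>u\<close> to \<open>v\<close> without increasing the weights.\<close>
  have "hausdorff_premeasure u 1 A \<le> 0"
    using hausdorff_premeasure_le_measure[of 1 u A] null by simp
  also have "0 < ennreal (\<epsilon> / 2)" using \<open>0 < \<epsilon>\<close> by simp
  finally obtain U where U: "A \<subseteq> (\<Union>i. U i)" "\<And>i. bounded (U i)" "\<And>i. diameter (U i) \<le> 1"
    "(\<Sum>i. diam_pow u (U i)) < ennreal (\<epsilon> / 2)"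
    by (rule hausdorff_premeasure_lessE) (rule that)
  define D where "D i = (if U i = {} then 0 else diameter (U i))" for i
  have D: "0 \<le> D i" "D i \<le> 1" "ennreal (D i powr v) \<le> diam_pow u (U i)" for i
  proof -
    show "0 \<le> D i" using U(2) by (simp add: D_def diameter_ge_0)
    show "D i \<le> 1" using U(3) by (simp add: D_def)
    show "ennreal (D i powr v) \<le> diam_pow u (U i)"
      using \<open>0 \<le> D i\<close> \<open>D i \<le> 1\<close> uv powr_le1[of v "D i"]
      by (auto simp: diam_pow_def D_def ennreal_leI powr_mono' split: if_splits)
  qed
  \<comment> \<open>The inflation is added to the \<open>v\<close>-th powers, so its total weight is
    at most half of \<epsilon>, the other half being left for the cover itself.\<close>
  define d where "d i = (D i powr v + \<epsilon> / 2 * (1/2) ^ Suc i) powr (1 / v)" for i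
  have pos: "0 < D i powr v + \<epsilon> / 2 * (1/2) ^ Suc i" for i
    using \<open>0 < \<epsilon>\<close> by (intro add_nonneg_pos) auto
  have d_powr: "d i powr v = D i powr v + \<epsilon> / 2 * (1/2) ^ Suc i" for i
    using pos[of i] uv by (simp add: d_def powr_powr)
  show ?thesis
  proof (rule that[OF U(1)])
    show d_pos: "0 < d i" for i using pos[of i] by (simp add: d_def)
    have D_le: "D i \<le> d i" for i
    proof (rule ccontr)
      assume "\<not> D i \<le> d i"
      then have "d i powr v < D i powr v" using d_pos[of i] uv by (intro powr_less_mono2) auto
      moreover have "0 < \<epsilon> / 2 * (1/2) ^ Suc i" using \<open>0 < \<epsilon>\<close> by simp
      ultimately show False using d_powr[of i] by linarith
    qed
    show "dist a b \<le> d i" if "a \<in> U i" "b \<in> U i" for i a b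
      using diameter_bounded_bound[OF U(2) that] D_le[of i] that by (auto simp: D_def split: if_splits)
    show "(\<Sum>i\<in>S. d i powr v) \<le> \<epsilon>" if S: "finite S" for S
    proof -
      have "ennreal (\<Sum>i\<in>S. D i powr v) = (\<Sum>i\<in>S. ennreal (D i powr v))" by (simp add: sum_ennreal)
      also have "\<dots> \<le> (\<Sum>i\<in>S. diam_pow u (U i))" by (intro sum_mono D)
      also have "\<dots> \<le> (\<Sum>i. diam_pow u (U i))" by (intro sum_le_suminf S) auto
      also have "\<dots> < ennreal (\<epsilon> / 2)" by (rule U)
      finally have "(\<Sum>i\<in>S. D i powr v) < \<epsilon> / 2"
        using \<open>0 < \<epsilon>\<close> by (subst (asm) ennreal_less_iff) (auto intro: sum_nonneg)
      moreover have "(\<Sum>i\<in>S. (1/2) ^ Suc i) \<le> (1::real)"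
        using sum_le_suminf[of "\<lambda>i. (1/2::real) ^ Suc i" S] power_half_series S
        by (auto simp: sums_iff)
      then have "\<epsilon> / 2 * (\<Sum>i\<in>S. (1/2) ^ Suc i) \<le> \<epsilon> / 2 * 1"
        using \<open>0 < \<epsilon>\<close> by (intro mult_left_mono) auto
      ultimately show ?thesis by (simp add: d_powr sum.distrib sum_distrib_left)
    qed
  qed
qed

section \<open>The dimension bound\<close>

text \<open>Small balls of \<open>F\<close> lie in a compact neighbourhood contained in
  \<open>F\<close>, of which they are closed parts.\<close>

lemma locally_compact_compact_ball:
  fixes F :: "'a::metric_space set"
  assumes "locally compact F" "x \<in> F"
  obtains e where "e > 0" "\<And>r. r \<le> e \<Longrightarrow> compact (cball x r \<inter> F)"
proof -
  obtain u K where u: "openin (top_of_set F) u" "x \<in> u" and K: "compact K" "u \<subseteq> K" "K \<subseteq> F"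
    using assms(1)[unfolded locally_def, rule_format, of F x] assms(2) by auto
  then obtain e where e: "e > 0" "cball x e \<inter> F \<subseteq> u"
    by (auto simp: openin_contains_cball)
  have "compact (cball x r \<inter> F)" if "r \<le> e" for r
  proof -
    have "cball x r \<inter> F = cball x r \<inter> K" using that e K by fastforce
    then show ?thesis using K(1) by (simp add: closed_Int_compact)
  qed
  with e(1) show ?thesis using that by blast
qed

text \<open>A limit point of the centres works: each closed ball contains all later centres.
  Compactness of \<open>K\<close> puts the limit in \<open>K\<close> although the ambient space need
  not be complete.\<close>

lemma compact_nested_cballs:
  fixes X :: "nat \<Rightarrow> 'a::metric_space"
  assumes "compact K" "\<And>n. X n \<in> K" "\<And>n. 0 \<le> R n" "\<And>n. cball (X (Suc n)) (R (Suc n)) \<subseteq> cball (X n) (R n)"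
  obtains z where "z \<in> K" "\<And>n. z \<in> cball (X n) (R n)"
proof -
  obtain z g where z: "z \<in> K" "strict_mono g" "(X \<circ> g) \<longlonglongrightarrow> z"
    using assms(1,2) unfolding compact_def by blast
  have anti: "cball (X m) (R m) \<subseteq> cball (X n) (R n)" if "n \<le> m" for m n
    using that by (rule lift_Suc_antimono_le[of "\<lambda>n. cball (X n) (R n)", rotated]) (rule assms(4))
  have "z \<in> cball (X n) (R n)" for n
  proof (rule Lim_in_closed_set[OF closed_cball _ _ z(3)])
    have "(X \<circ> g) m \<in> cball (X n) (R n)" if "m \<ge> n" for m
    proof -
      have "g m \<ge> n" using that seq_suble[OF z(2), of m] by simp
      moreover have "X (g m) \<in> cball (X (g m)) (R (g m))" using assms(3) by simp
      ultimately show ?thesis using anti unfolding comp_def by blast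
    qed
    then show "eventually (\<lambda>m. (X \<circ> g) m \<in> cball (X n) (R n)) sequentially"
      by (auto simp: eventually_sequentially)
  qed simp
  with z(1) show ?thesis using that by blast
qed

context ad_regular_rationals
begin

text \<open>Measure zero would allow covers of arbitrarily small weight at an exponent slightly
  above \<open>u\<close>; iterating \<open>avoidance_step\<close> then produces a point of the set
  that the cover misses.\<close>

lemma hausdorff_measure_well_approx_pos:
  assumes lc: "locally compact F" and x: "x \<in> F" and "0 < r"
    and null: "hausdorff_measure s ((cball x r \<inter> F) - well_approx F P \<delta>) = 0"
    and \<delta>: "0 < \<delta>" "\<delta> \<le> t" and u: "0 \<le> u" "u * t < \<delta> * s"
  shows "hausdorff_measure u (well_approx F P t) \<noteq> 0"
proof
  assume zero: "hausdorff_measure u (well_approx F P t) = 0"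
  have "t > 0" using \<delta> by simp
  have "u < \<delta> * s / t" using u(2) \<open>t > 0\<close> by (simp add: less_divide_eq)
  then obtain v where "u < v" "v < \<delta> * s / t" using dense by blast
  then have v: "u < v" "0 < v" "v * t < \<delta> * s" using \<open>t > 0\<close> u(1) by (auto simp: less_divide_eq)
  obtain e where e: "e > 0" "\<And>r. r \<le> e \<Longrightarrow> compact (cball x r \<inter> F)"
    using locally_compact_compact_ball[OF lc x] by blast
  define r0 where "r0 = min r (min e (1/2))"
  have r0: "0 < r0" "r0 \<le> r" "r0 \<le> e" "r0 \<le> 1/2" using \<open>0 < r\<close> e(1) by (auto simp: r0_def)
  \<comment> \<open>The largest value of \<open>\<theta> powr s\<close> that
    \<open>avoidance_step\<close> permits.\<close>
  define a where "a = 1 / (4 * C\<^sup>2 * 8 powr s) / (C\<^sup>2 * 4 powr s)"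
  have "a > 0" using C_pos by (simp add: a_def)
  define \<theta> where "\<theta> = min (1/4) (a powr (1 / s))"
  have "\<theta> powr s \<le> (a powr (1 / s)) powr s"
    using s_pos \<open>a > 0\<close> by (intro powr_mono2) (auto simp: \<theta>_def)
  then have "\<theta> powr s \<le> a" using s_pos \<open>a > 0\<close> by (simp add: powr_powr)
  then have "C\<^sup>2 * 4 powr s * \<theta> powr s \<le> C\<^sup>2 * 4 powr s * a" by (intro mult_left_mono) auto
  also have "\<dots> = 1 / (4 * C\<^sup>2 * 8 powr s)" using C_pos by (simp add: a_def)
  finally have \<theta>: "0 < \<theta>" "\<theta> \<le> 1/4" "C\<^sup>2 * 4 powr s * \<theta> powr s \<le> 1 / (4 * C\<^sup>2 * 8 powr s)"
    using \<open>a > 0\<close> by (auto simp: \<theta>_def)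
  \<comment> \<open>This is the weight allowed to the whole cover, which makes the initial ball
    \<open>good\<close>.\<close>
  have "0 < (\<theta> * r0) powr v" using \<theta> r0 by simp
  then obtain U :: "nat \<Rightarrow> 'a set" and d :: "nat \<Rightarrow> real"
    where cover: "well_approx F P t \<subseteq> (\<Union>i. U i)" and d: "\<And>i. 0 < d i"
      "\<And>i a b. \<lbrakk>a \<in> U i; b \<in> U i\<rbrakk> \<Longrightarrow> dist a b \<le> d i"
    and small: "\<And>S. finite S \<Longrightarrow> (\<Sum>i\<in>S. d i powr v) \<le> (\<theta> * r0) powr v"
    by (rule null_imp_small_cover[OF zero u(1) v(1)]) (rule that)
  define good where "good = (\<lambda>(y, \<rho>). y \<in> F \<and> 0 < \<rho> \<and> \<rho> \<le> 1/2 \<and> cball y \<rho> \<subseteq> cball x r0 \<and>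
      sparse_cover U d v (\<theta> * \<rho>) (cball y \<rho>))"
  \<comment> \<open>Requiring \<open>q > n\<close> at step \<open>n\<close> makes the denominators
    unbounded: the common point is approximated infinitely often and the radii tend to 0.\<close>
  define next_ball where "next_ball n = (\<lambda>(y, \<rho>) (y', \<rho>'). cball y' \<rho>' \<subseteq> cball y \<rho> \<and>
      (\<exists>q>n. y' \<in> P q \<and> \<rho>' = 1 / real q powr t))" for n :: nat
  have "good (x, r0)" using x r0 small by (auto simp: good_def sparse_cover_def)
  have step: "\<exists>b'. good b' \<and> next_ball n b b'" if "good b" for b n
  proof -
    obtain y \<rho> where b: "b = (y, \<rho>)" by force
    have y: "y \<in> F" "0 < \<rho>" "\<rho> \<le> 1/2" "cball y \<rho> \<subseteq> cball x r0"
      "sparse_cover U d v (\<theta> * \<rho>) (cball y \<rho>)"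
      using that by (auto simp: good_def b)
    \<comment> \<open>Full measure in one ball is inherited by all balls inside it, so the step can
      be repeated.\<close>
    have "cball y \<rho> \<inter> F - well_approx F P \<delta> \<subseteq> cball x r \<inter> F - well_approx F P \<delta>"
      using y(4) r0(2) by fastforce
    then have null': "hausdorff_measure s ((cball y \<rho> \<inter> F) - well_approx F P \<delta>) = 0"
      using hausdorff_measure_mono null by (metis le_zero_eq)
    from avoidance_step[OF y(1-3) \<delta> v(2,3) null' d \<theta> y(5), of n]
    obtain q p where q: "q > n" "p \<in> P q" "1 / real q powr t \<le> \<rho>"
      "cball p (1 / real q powr t) \<subseteq> cball y \<rho>"
      "sparse_cover U d v (\<theta> * (1 / real q powr t)) (cball p (1 / real q powr t))"
      by blast
    have "p \<in> F" using rationals_subset[of q] q by auto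
    moreover have "1 / real q powr t \<le> 1/2" using q(3) y(3) by (rule order_trans)
    moreover have "cball p (1 / real q powr t) \<subseteq> cball x r0" using q(4) y(4) by (rule order_trans)
    moreover have "0 < 1 / real q powr t" using q(1) by simp
    ultimately have "good (p, 1 / real q powr t)" using q(5) unfolding good_def by blast
    moreover have "next_ball n b (p, 1 / real q powr t)"
      unfolding next_ball_def b using q by blast
    ultimately show ?thesis by blast
  qed
  have "\<exists>f. \<forall>n. good (f n) \<and> next_ball n (f n) (f (Suc n))"
    by (rule dependent_nat_choice) (use \<open>good (x, r0)\<close> step in blast)+
  then obtain f where f: "\<And>n. good (f n)" "\<And>n. next_ball n (f n) (f (Suc n))" by blast
  define X where "X n = fst (f n)" for n
  define R where "R n = snd (f n)" for n
  have XR: "X n \<in> F" "0 < R n" "cball (X n) (R n) \<subseteq> cball x r0" "sparse_cover U d v (\<theta> * R n) (cball (X n) (R n))" for n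
    using f(1)[of n] by (auto simp: good_def X_def R_def case_prod_unfold)
  have nested: "cball (X (Suc n)) (R (Suc n)) \<subseteq> cball (X n) (R n)"
    and approx: "\<exists>q>n. X (Suc n) \<in> P q \<and> R (Suc n) = 1 / real q powr t" for n
    using f(2)[of n] by (auto simp: next_ball_def X_def R_def case_prod_unfold)
  have "X n \<in> cball x r0 \<inter> F" for n
  proof -
    have "X n \<in> cball (X n) (R n)" using XR(2)[of n] by simp
    then show ?thesis using XR(1,3)[of n] by blast
  qed
  then obtain z where z: "z \<in> cball x r0 \<inter> F" "\<And>n. z \<in> cball (X n) (R n)"
    by (rule compact_nested_cballs[where X = X and R = R, OF e(2)[OF r0(3)] _ less_imp_le[OF XR(2)] nested])
      (rule that)
  have "z \<in> well_approx F P t"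
    unfolding well_approx_iff
  proof (intro conjI allI)
    fix N
    obtain q where "q > N" "X (Suc N) \<in> P q" "R (Suc N) = 1 / real q powr t" using approx by blast
    with z(2)[of "Suc N"] show "\<exists>q>N. \<exists>p\<in>P q. dist p z \<le> 1 / real q powr t" by auto
  qed (use z in simp)
  with cover obtain i where i: "z \<in> U i" by blast
  have le: "d i \<le> \<theta> * R n" for n
  proof (rule sparse_cover_single[OF XR(4) v(2)])
    show "0 \<le> \<theta> * R n" using \<theta>(1) XR(2)[of n] by simp
    show "U i \<inter> cball (X n) (R n) \<noteq> {}" using z(2)[of n] i by blast
  qed
  \<comment> \<open>A radius this small forces \<open>d i \<le> d i / 2\<close>, which is absurd
    since \<open>d i\<close> is positive.\<close>
  have "0 < d i / (2 * \<theta>)" using d(1)[of i] \<theta>(1) by simp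
  then obtain N where N: "N \<ge> 0" "\<And>q. q > N \<Longrightarrow> 1 / real q powr t \<le> d i / (2 * \<theta>)"
    by (rule inverse_powr_small[OF \<open>t > 0\<close>]) (rule that)
  obtain q where q: "q > N" "R (Suc N) = 1 / real q powr t" using approx[of N] by blast
  have "d i \<le> \<theta> * (d i / (2 * \<theta>))"
    using le[of "Suc N"] N(2)[OF q(1)] q(2) \<theta>(1) by (smt (verit) mult_left_mono)
  then show False using d(1)[of i] \<theta>(1) by simp
qed

section \<open>Consequences for the Dirichlet exponent and the Hausdorff dimension\<close>

lemma dirichlet_exponent_ge_1:
  assumes "F \<noteq> {}"
  shows "1 \<le> dirichlet_exponent s F P"
proof -
  obtain x where "x \<in> F" using assms by blast
  have "cball x 1 \<inter> F - well_approx F P 1 = {}" by (auto simp: well_approx_1)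
  then have "hausdorff_measure s (cball x 1 \<inter> F - well_approx F P 1) = 0"
    by (simp only: hausdorff_measure_empty)
  then show ?thesis unfolding dirichlet_exponent_def one_ereal_def
    using \<open>x \<in> F\<close> zero_less_one by (intro Sup_upper) blast
qed

lemma dirichlet_exponent_le: "dirichlet_exponent s F P \<le> ereal (1 + 1 / s)"
  unfolding dirichlet_exponent_def
  by (intro Sup_least) (auto dest: full_measure_exponent_le)

text \<open>The dimension is an infimum over exponents of measure zero, so each of these is compared
  with the bound. An exponent \<open>u\<close> below it has \<open>u * t / s\<close> below the
  supremum, hence below an admissible \<delta>, and positivity at \<open>u\<close> follows.\<close>

lemma hausdorff_dim_well_approx_ge:
  assumes lc: "locally compact F" and "F \<noteq> {}" and t: "dirichlet_exponent s F P \<le> ereal t"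
  shows "dirichlet_exponent s F P * ereal s / ereal t \<le> hausdorff_dim (well_approx F P t)"
  unfolding hausdorff_dim_def
proof (rule Inf_greatest, clarify)
  fix u assume u: "0 \<le> u" "hausdorff_measure u (well_approx F P t) = 0"
  \<comment> \<open>The bounds 1 and \<open>1 + 1 / s\<close> make the exponent a real number, which
    reduces the extended arithmetic to real arithmetic and gives \<open>t > 0\<close>.\<close>
  obtain D where D: "dirichlet_exponent s F P = ereal D" "1 \<le> D"
    using dirichlet_exponent_ge_1[OF \<open>F \<noteq> {}\<close>] dirichlet_exponent_le
    by (cases "dirichlet_exponent s F P") (auto simp: one_ereal_def)
  have "t > 0" using t D by simp
  have "\<not> u < D * s / t"
  proof
    assume "u < D * s / t"
    then have "u * t / s < D" using \<open>t > 0\<close> s_pos by (simp add: field_simps)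
    then have "ereal (u * t / s) < dirichlet_exponent s F P" by (simp add: D)
    then obtain \<delta> x r where \<delta>: "u * t / s < \<delta>" "0 < \<delta>" and x: "x \<in> F" "0 < r"
      and null: "hausdorff_measure s ((cball x r \<inter> F) - well_approx F P \<delta>) = 0"
      unfolding dirichlet_exponent_def less_Sup_iff by auto
    have "ereal \<delta> \<le> dirichlet_exponent s F P"
      unfolding dirichlet_exponent_def using \<delta> x null by (intro Sup_upper) blast
    then have "\<delta> \<le> t" using t by (simp add: D)
    moreover have "u * t < \<delta> * s" using \<delta>(1) s_pos by (simp add: divide_less_eq)
    ultimately show False
      using hausdorff_measure_well_approx_pos[OF lc x null \<delta>(2) _ u(1)] u(2) by blast
  qed
  then show "dirichlet_exponent s F P * ereal s / ereal t \<le> ereal u"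
    using \<open>t > 0\<close> by (simp add: D not_less)
qed

end

theorem proposition3p1:
  fixes s :: real and F :: "'a::metric_space set"
  assumes "s > 0"
    and "F \<noteq> {}"
    and "totally_bounded F"
    and "locally compact F"
    and "ahlfors_david_regular s F"
  shows "dirichlet_spectrum s F \<subseteq> {1 .. ereal (1 + 1 / s)} \<and>
    (\<forall>P. abstract_rationals F P \<longrightarrow>
      (\<forall>t::real. dirichlet_exponent s F P \<le> ereal t \<longrightarrow>
        hausdorff_dim (well_approx F P t) \<ge> dirichlet_exponent s F P * ereal s / ereal t))"
proof -
  obtain C where "C > 0" and C: "\<And>r x. \<lbrakk>0 < r; r < 1; x \<in> F\<rbrakk> \<Longrightarrow>
      ennreal (r powr s / C) \<le> hausdorff_measure s (cball x r \<inter> F) \<and>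
      hausdorff_measure s (cball x r \<inter> F) \<le> ennreal (C * r powr s)"
    using \<open>ahlfors_david_regular s F\<close> unfolding ahlfors_david_regular_def by blast
  have "ad_regular_rationals s C F P" if "abstract_rationals F P" for P
    by unfold_locales (use \<open>s > 0\<close> \<open>C > 0\<close> C that in auto)
  note rationals = ad_regular_rationals.dirichlet_exponent_ge_1[OF this]
    ad_regular_rationals.dirichlet_exponent_le[OF this]
    ad_regular_rationals.hausdorff_dim_well_approx_ge[OF this]
  show ?thesis
    using rationals \<open>F \<noteq> {}\<close> \<open>locally compact F\<close> by (auto simp: dirichlet_spectrum_def)
qed

end
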